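(* For all $\mu,\nu\in \mathrm{M}_0(\mathbb{R}^d)$, the set $\Gamma_{0,\mathrm{cm}}(\mu,\nu)$ of zero-couplings between $\mu$ and $\nu$ with cyclically monotone support is nonempty.
   Context: $\mathrm{M}_0(\mathbb{R}^k)$ denotes the set of nonnegative Borel measures $\mu$ on $\mathbb{R}^k\setminus\{0\}$ such that $\mu(B)<\infty$ for every Borel set $B\subset\mathbb{R}^k\setminus\{0\}$ that is bounded away from the origin, i.e. $0\notin \mathrm{cl}(B)$ (closure in $\mathbb{R}^k$); the total mass may be infinite. The support $\mathrm{spt}\,\mu$ of such a measure is the set of $x\in\mathbb{R}^k$ such that $\mu(U\setminus\{0\})>0$ for every open $U\subset\mathbb{R}^k$ containing $x$ (so $0$ may belong to $\mathrm{spt}\,\mu$). For $\mu,\nu\in\mathrm{M}_0(\mathbb{R}^d)$, a zero-coupling between $\mu$ and $\nu$ is a nonnegative Borel measure $\gamma$ on $(\mathbb{R}^d\times\mathbb{R}^d)\setminus\{(0,0)\}$ such that $\gamma(A\times\mathbb{R}^d)=\mu(A)$ and $\gamma(\mathbb{R}^d\times A)=\nu(A)$ for all Borel $A\subset\mathbb{R}^d\setminus\{0\}$; any such $\gamma$ belongs to $\mathrm{M}_0(\mathbb{R}^d\times\mathbb{R}^d)=\mathrm{M}_0(\mathbb{R}^{2d})$, so its support $\mathrm{spt}\,\gamma\subset\mathbb{R}^d\times\mathbb{R}^d$ is the set of $(x,y)\in\mathbb{R}^d\times\mathbb{R}^d$ such that $\gamma(U\setminus\{(0,0)\})>0$ for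 every open $U\subset\mathbb{R}^d\times\mathbb{R}^d$ containing $(x,y)$. $\Gamma_{0,\mathrm{cm}}(\mu,\nu)$ is the set of zero-couplings $\gamma$ between $\mu$ and $\nu$ such that $\mathrm{spt}\,\gamma$ is cyclically monotone. A set $T\subset\mathbb{R}^d\times\mathbb{R}^d$ is cyclically monotone if for every integer $n\ge 2$ and all $(x_1,y_1),\dots,(x_n,y_n)\in T$, with $y_{n+1}:=y_1$, one has $\sum_{i=1}^n\langle x_i,y_i\rangle\ge\sum_{i=1}^n\langle x_i,y_{i+1}\rangle$. *)

theory Defs
  imports "HOL-Analysis.Analysis"
begin

abbreviation punctured_borel :: "'a::real_normed_vector measure" where
  "punctured_borel \<equiv> restrict_space borel (- {0})"

(* The sigma-algebra of mu fixes its space to be - {0}; the measure carried by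
   punctured_borel itself plays no role. *)
definition M0 :: "'a::real_normed_vector measure set" where
  "M0 = {\<mu>. sets \<mu> = sets punctured_borel \<and>
             (\<forall>B\<in>sets \<mu>. 0 \<notin> closure B \<longrightarrow> emeasure \<mu> B < \<infinity>)}"

(* The support is a subset of the whole space, so it may contain 0. *)
definition spt :: "'a::real_normed_vector measure \<Rightarrow> 'a set" where
  "spt \<mu> = {x. \<forall>U. open U \<and> x \<in> U \<longrightarrow> emeasure \<mu> (U - {0}) > 0}"

(* 0 on the product type is (0, 0). The marginal conditions only concern sets A
   not containing 0, so mass on {0} x (R^d - {0}) is invisible to mu and mass on
   (R^d - {0}) x {0} is invisible to nu. *)
definition zero_couplings ::
    "'a::real_normed_vector measure \<Rightarrow> 'a measure \<Rightarrow> ('a \<times> 'a) measure set" where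
  "zero_couplings \<mu> \<nu> = {\<gamma>. sets \<gamma> = sets punctured_borel \<and>
      (\<forall>A\<in>sets punctured_borel.
          emeasure \<gamma> (A \<times> UNIV) = emeasure \<mu> A \<and>
          emeasure \<gamma> (UNIV \<times> A) = emeasure \<nu> A)}"

definition cyclically_monotone :: "('a::real_inner \<times> 'a) set \<Rightarrow> bool" where
  "cyclically_monotone T \<longleftrightarrow>
     (\<forall>n\<ge>2. \<forall>x y :: nat \<Rightarrow> 'a.
        (\<forall>i\<in>{1..n}. (x i, y i) \<in> T) \<and> y (n + 1) = y 1 \<longrightarrow>
        (\<Sum>i=1..n. x i \<bullet> y i) \<ge> (\<Sum>i=1..n. x i \<bullet> y (i + 1)))"

definition zero_couplings_cm ::
    "'a::real_inner measure \<Rightarrow> 'a measure \<Rightarrow> ('a \<times> 'a) measure set" where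
  "zero_couplings_cm \<mu> \<nu> = {\<gamma> \<in> zero_couplings \<mu> \<nu>. cyclically_monotone (spt \<gamma>)}"

end

theory Submission
  imports Defs
begin

text \<open>
  For finitely supported measures of equal mass, a transport plan maximising
  \<open>\<Sum>z. \<pi> z * (fst z \<bullet> snd z)\<close> exists by compactness, and it can put mass only on a cyclically
  monotone set: moving a little mass along a violating cycle would preserve the marginals and
  increase the objective (\<open>cyclically_monotone_finite_plan\<close>). Rounding the points of the space to a
  finite set transfers this to arbitrary finite measures, at the price that the coupling is
  cyclically monotone only after rounding (\<open>coupling_near_cyclically_monotone\<close>).

  Given \<open>\<mu>\<close> and \<open>\<nu>\<close>, remove the ball of radius \<open>r n = 1 / (n + 1)\<close> from both and place at the
  origin an atom carrying the remaining mass of the other measure. The two truncations are finite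
  and have equal mass, so they have such a coupling \<open>\<gamma> n\<close>; on sets that avoid the ball its marginals
  are those of \<open>\<mu>\<close> and \<open>\<nu>\<close>.

  The couplings \<open>\<gamma> n\<close> are then made to converge. By Tychonoff's theorem there is a filter along
  which \<open>emeasure (\<gamma> n) C\<close> converges for every set \<open>C\<close> at once (\<open>setwise_cluster_point\<close>). The limit
  \<open>\<beta>\<close> is additive with the right marginals away from the origin, but in general not countably additive:
  mass of \<open>\<gamma> n\<close> can slide onto \<open>A \<times> {0}\<close>, say, and \<open>\<nu>\<close> does not control what happens near \<open>0\<close>.
  Countable additivity does hold on the semiring of those rectangles \<open>A \<times> B\<close> whose sides have the
  origin off their boundary and do not both contain it. Such sides can be approximated by compact
  sets from inside and by open sets from outside with errors that stay away from the origin, where the marginals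
  bound \<open>\<beta>\<close>; the usual compactness argument applies (\<open>measure_extending_content\<close>). Caratheodory's
  theorem turns \<open>\<beta>\<close> on these rectangles into a measure, which is the desired zero-coupling.

  The open rectangles among them form a base of the topology off the origin. Hence every neighbourhood of
  a point in the support of the limit contains one that is charged by \<open>\<gamma> n\<close> eventually along the
  filter, so finitely many points of the support can be approximated simultaneously within one
  cyclically monotone set. Cyclic monotonicity involves finitely many points at a time and is a
  closed condition (\<open>cyclically_monotone_if_approximable\<close>), so it passes to the limit. The origin
  needs no separate treatment: if it lies in the support, its punctured neighbourhoods are charged.
\<close>

section \<open>Cyclic monotonicity and finite transport problems\<close>

text \<open>
  The finite sets \<open>F\<close> must be approximated inside a single \<open>S\<close>, since a cycle uses several points at
  once. Along \<open>\<delta> = 1 / (k + 1)\<close> the approximating cycles converge pointwise and the inequality passes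
  to the limit.
\<close>

lemma cyclically_monotone_if_approximable:
  fixes T :: "('a::real_inner \<times> 'a) set"
  assumes approx: "\<And>F \<delta>. finite F \<Longrightarrow> F \<subseteq> T \<Longrightarrow> \<delta> > 0 \<Longrightarrow>
    \<exists>S. cyclically_monotone S \<and> (\<forall>p\<in>F. \<exists>q\<in>S. dist p q < \<delta>)"
  shows "cyclically_monotone T"
  unfolding cyclically_monotone_def
proof (intro allI impI, elim conjE)
  fix n :: nat and x y :: "nat \<Rightarrow> 'a"
  assume n: "2 \<le> n" and T: "\<forall>i\<in>{1..n}. (x i, y i) \<in> T" and cyc: "y (n + 1) = y 1"
  define F where "F = (\<lambda>i. (x i, y i)) ` {1..n}"
  have F: "finite F" "F \<subseteq> T"
    using T by (auto simp: F_def)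
  have "\<exists>S. cyclically_monotone S \<and> (\<forall>p\<in>F. \<exists>q\<in>S. dist p q < inverse (real (Suc k)))" for k
    by (rule approx[OF F]) simp
  then obtain S where S: "\<And>k. cyclically_monotone (S k)"
    and "\<And>k. \<forall>p\<in>F. \<exists>q\<in>S k. dist p q < inverse (real (Suc k))"
    by metis
  then obtain Q where Q: "\<And>k p. p \<in> F \<Longrightarrow> Q k p \<in> S k"
    "\<And>k p. p \<in> F \<Longrightarrow> dist p (Q k p) < inverse (real (Suc k))"
    by metis
  \<comment> \<open>A cycle closes at index \<open>n + 1\<close>; sending that index back to \<open>1\<close> makes the approximating
      cycles close exactly.\<close>
  define j where "j i = (if i = n + 1 then 1 else i)" for i :: nat
  have jF: "(x (j i), y (j i)) \<in> F" if "i \<in> {1..n+1}" for i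
    using that n by (auto simp: F_def j_def)
  define z where "z k i = Q k (x (j i), y (j i))" for k i
  have lim: "(\<lambda>k. z k i) \<longlonglongrightarrow> (x (j i), y (j i))" if "i \<in> {1..n+1}" for i
  proof (rule metric_tendsto_imp_tendsto[OF LIMSEQ_inverse_real_of_nat])
    show "\<forall>\<^sub>F k in sequentially. dist (z k i) (x (j i), y (j i)) \<le> dist (inverse (real (Suc k))) 0"
      using Q(2)[OF jF[OF that]] by (intro always_eventually) (auto simp: z_def dist_commute less_imp_le)
  qed
  have limx: "(\<lambda>k. fst (z k i)) \<longlonglongrightarrow> x i" if "i \<in> {1..n}" for i
    using tendsto_fst[OF lim[of i]] that by (auto simp: j_def)
  have limy: "(\<lambda>k. snd (z k i)) \<longlonglongrightarrow> y i" if "i \<in> {1..n+1}" for i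
    using tendsto_snd[OF lim[of i]] that cyc by (auto simp: j_def split: if_splits)
  have "(\<Sum>i=1..n. fst (z k i) \<bullet> snd (z k (i + 1))) \<le> (\<Sum>i=1..n. fst (z k i) \<bullet> snd (z k i))" for k
  proof -
    have "\<forall>i\<in>{1..n}. (fst (z k i), snd (z k i)) \<in> S k"
      using Q(1)[OF jF] by (auto simp: z_def)
    moreover have "snd (z k (n + 1)) = snd (z k 1)"
      using n by (simp add: z_def j_def)
    ultimately show ?thesis
      using S[of k] n unfolding cyclically_monotone_def
      by (elim allE[where x=n] impE allE[where x="\<lambda>i. fst (z k i)"] allE[where x="\<lambda>i. snd (z k i)"]) auto
  qed
  then show "(\<Sum>i=1..n. x i \<bullet> y (i + 1)) \<le> (\<Sum>i=1..n. x i \<bullet> y i)"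
    by (intro LIMSEQ_le[where X="\<lambda>k. \<Sum>i=1..n. fst (z k i) \<bullet> snd (z k (i + 1))"
          and Y="\<lambda>k. \<Sum>i=1..n. fst (z k i) \<bullet> snd (z k i)"] tendsto_sum tendsto_inner limx limy) auto
qed

lemma compact_PiE_UNIV:
  fixes S :: "'i \<Rightarrow> 'a::topological_space set"
  assumes "\<And>i. compact (S i)"
  shows "compact (PiE UNIV S)"
  using assms compactin_PiE[of "\<lambda>_. euclidean" UNIV S]
  by (simp add: euclidean_product_topology)

text \<open>
  A plan maximising the total inner product exists since the plans form a compact subset of a product
  of intervals. If its support contained points violating the inequality, then lowering the mass at
  each \<open>(x i, y i)\<close> and raising it at each \<open>(x i, y (i + 1))\<close> by the same small amount would give a
  better plan.
\<close>

lemma cyclically_monotone_finite_plan: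
  fixes F :: "'a::real_inner set" and p q :: "'a \<Rightarrow> real"
  assumes F: "finite F" and p: "\<And>s. s \<in> F \<Longrightarrow> 0 \<le> p s" and q: "\<And>t. t \<in> F \<Longrightarrow> 0 \<le> q t"
    and mass: "sum p F = sum q F"
  obtains \<pi> :: "'a \<times> 'a \<Rightarrow> real" where
    "\<And>z. 0 \<le> \<pi> z"
    "\<And>s. s \<in> F \<Longrightarrow> (\<Sum>t\<in>F. \<pi> (s, t)) = p s"
    "\<And>t. t \<in> F \<Longrightarrow> (\<Sum>s\<in>F. \<pi> (s, t)) = q t"
    "cyclically_monotone {z \<in> F \<times> F. 0 < \<pi> z}"
proof -
  define m where "m = sum p F"
  define Plans :: "('a \<times> 'a \<Rightarrow> real) set" where "Plans = {\<pi>. (\<forall>z. 0 \<le> \<pi> z \<and> (z \<notin> F \<times> F \<longrightarrow> \<pi> z = 0)) \<and>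
     (\<forall>s. s \<in> F \<longrightarrow> (\<Sum>t\<in>F. \<pi> (s, t)) = p s) \<and> (\<forall>t. t \<in> F \<longrightarrow> (\<Sum>s\<in>F. \<pi> (s, t)) = q t)}"
  define V where "V \<pi> = (\<Sum>z\<in>F\<times>F. \<pi> z * (fst z \<bullet> snd z))" for \<pi> :: "'a \<times> 'a \<Rightarrow> real"
  have "closed Plans"
    unfolding Plans_def
    by (intro closed_Collect_conj closed_Collect_all closed_Collect_imp closed_Collect_le
        closed_Collect_eq open_Collect_const continuous_intros continuous_on_product_coordinates)
  moreover have "compact (PiE UNIV (\<lambda>_::'a\<times>'a. {0..m}))"
    by (rule compact_PiE_UNIV) simp
  moreover have "Plans \<subseteq> PiE UNIV (\<lambda>_::'a\<times>'a. {0..m})"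
  proof
    fix \<pi> assume \<pi>: "\<pi> \<in> Plans"
    have "\<pi> (s, t) \<le> m" for s t
    proof (cases "(s, t) \<in> F \<times> F")
      case True
      then have "\<pi> (s, t) \<le> (\<Sum>t\<in>F. \<pi> (s, t))"
        using \<pi> F by (intro member_le_sum) (auto simp: Plans_def)
      also have "\<dots> = p s"
        using \<pi> True by (auto simp: Plans_def)
      also have "\<dots> \<le> m"
        unfolding m_def using F True p by (intro member_le_sum) auto
      finally show ?thesis .
    next
      case False
      then have "\<pi> (s, t) = 0"
        using \<pi> by (simp add: Plans_def)
      then show ?thesis
        using p by (simp add: m_def sum_nonneg)
    qed
    with \<pi> show "\<pi> \<in> PiE UNIV (\<lambda>_. {0..m})"
      by (auto simp: Plans_def)
  qed
  ultimately have "compact Plans"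
    by (metis closed_Int_compact inf.absorb_iff1)
  moreover have "Plans \<noteq> {}"
  proof -
    \<comment> \<open>The product plan; for total mass zero, division by zero makes it the zero plan.\<close>
    have 0: "p s = 0" "q s = 0" if "m = 0" "s \<in> F" for s
      using that F p q mass by (auto simp: m_def sum_nonneg_eq_0_iff)
    have "(\<lambda>(s, t). if s \<in> F \<and> t \<in> F then p s * q t / m else 0) \<in> Plans"
      using F p q mass[symmetric] 0
      by (auto simp: Plans_def m_def sum_nonneg simp flip: sum_divide_distrib sum_distrib_left sum_distrib_right)
    then show ?thesis
      by blast
  qed
  moreover have "continuous_on Plans V"
    unfolding V_def by (intro continuous_intros continuous_on_product_coordinates[THEN continuous_on_subset]) auto
  ultimately obtain \<pi> where \<pi>: "\<pi> \<in> Plans" and max: "\<And>\<pi>'. \<pi>' \<in> Plans \<Longrightarrow> V \<pi>' \<le> V \<pi>"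
    using continuous_attains_sup by metis
  have \<pi>_nonneg: "0 \<le> \<pi> z" for z
    using \<pi> unfolding Plans_def by blast
  have \<pi>_out: "\<pi> z = 0" if "z \<notin> F \<times> F" for z
    using \<pi> that unfolding Plans_def by blast
  have \<pi>_row: "(\<Sum>t\<in>F. \<pi> (s, t)) = p s" if "s \<in> F" for s
    using \<pi> that unfolding Plans_def by blast
  have \<pi>_col: "(\<Sum>s\<in>F. \<pi> (s, t)) = q t" if "t \<in> F" for t
    using \<pi> that unfolding Plans_def by blast
  have "cyclically_monotone {z \<in> F \<times> F. 0 < \<pi> z}"
    unfolding cyclically_monotone_def
  proof (intro allI impI, elim conjE)
    fix n :: nat and x y :: "nat \<Rightarrow> 'a"
    assume n: "2 \<le> n" and supp: "\<forall>i\<in>{1..n}. (x i, y i) \<in> {z \<in> F \<times> F. 0 < \<pi> z}"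
      and cyc: "y (n + 1) = y 1"
    have xF: "x i \<in> F" if "i \<in> {1..n}" for i
      using supp that by auto
    have yF: "y i \<in> F" if "i \<in> {1..n}" for i
      using supp that by auto
    have yF': "y (Suc i) \<in> F" if "i \<in> {1..n}" for i
      using supp that cyc by (cases "i = n") auto
    have shift: "(\<Sum>i=1..n. h (y (Suc i))) = (\<Sum>i=1..n. h (y i))" for h :: "'a \<Rightarrow> real"
    proof -
      have "(\<Sum>i=1..n. h (y (Suc i))) = (\<Sum>i=1..<n. h (y (Suc i))) + h (y 1)"
        using n cyc by (cases n) (auto simp: atLeastLessThanSuc_atLeastAtMost)
      also have "(\<Sum>i=1..<n. h (y (Suc i))) = (\<Sum>i=2..n. h (y i))"
        using sum.shift_bounds_Suc_ivl[of "\<lambda>i. h (y i)" 1 n] 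
        by (simp add: atLeastLessThanSuc_atLeastAtMost numeral_2_eq_2)
      also have "\<dots> + h (y 1) = (\<Sum>i=1..n. h (y i))"
        using n sum.atLeast_Suc_atMost[of 1 n "\<lambda>i. h (y i)"] by (simp add: numeral_2_eq_2)
      finally show ?thesis .
    qed
    \<comment> \<open>A pair may occur up to \<open>n\<close> times in the cycle, so each occurrence may take away at most one
        \<open>n\<close>-th of the smallest mass in it.\<close>
    define \<epsilon> where "\<epsilon> = Min ((\<lambda>i. \<pi> (x i, y i)) ` {1..n}) / real n"
    have \<epsilon>: "\<epsilon> > 0"
      unfolding \<epsilon>_def using n supp by (intro divide_pos_pos) (auto simp: Min_gr_iff)
    have \<epsilon>_le: "real n * \<epsilon> \<le> \<pi> (x i, y i)" if "i \<in> {1..n}" for i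
      unfolding \<epsilon>_def using n that by auto
    \<comment> \<open>\<open>N w z\<close> counts the occurrences of \<open>z\<close> in \<open>w\<close>; repeated pairs are thereby moved
        with their multiplicity.\<close>
    define N where "N w z = (\<Sum>i=1..n. of_bool (w i = z) :: real)" for w :: "nat \<Rightarrow> 'a \<times> 'a" and z :: "'a \<times> 'a"
    define a where "a i = (x i, y i)" for i
    define b where "b i = (x i, y (Suc i))" for i
    define \<pi>' where "\<pi>' z = \<pi> z + \<epsilon> * (N b z - N a z)" for z :: "'a \<times> 'a"
    have row: "(\<Sum>t\<in>F. N (\<lambda>i. (x i, w i)) (s, t)) = (\<Sum>i=1..n. of_bool (x i = s))"
      if "\<And>i. i \<in> {1..n} \<Longrightarrow> w i \<in> F" for w s
    proof -
      have "(\<Sum>t\<in>F. N (\<lambda>i. (x i, w i)) (s, t)) = (\<Sum>i=1..n. \<Sum>t\<in>F. of_bool ((x i, w i) = (s, t)))"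
        unfolding N_def by (rule sum.swap)
      also have "\<dots> = (\<Sum>i=1..n. of_bool (x i = s))"
      proof (rule sum.cong)
        fix i assume "i \<in> {1..n}"
        then have "(\<Sum>t\<in>F. of_bool ((x i, w i) = (s, t))) = (\<Sum>t\<in>F. if w i = t then of_bool (x i = s) else (0::real))"
          by (intro sum.cong) auto
        with that \<open>i \<in> {1..n}\<close> show "(\<Sum>t\<in>F. of_bool ((x i, w i) = (s, t))) = (of_bool (x i = s) :: real)"
          using F by simp
      qed simp
      finally show ?thesis .
    qed
    have col: "(\<Sum>s\<in>F. N (\<lambda>i. (x i, w i)) (s, t)) = (\<Sum>i=1..n. of_bool (w i = t))" for w t
    proof -
      have "(\<Sum>s\<in>F. N (\<lambda>i. (x i, w i)) (s, t)) = (\<Sum>i=1..n. \<Sum>s\<in>F. of_bool ((x i, w i) = (s, t)))"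
        unfolding N_def by (rule sum.swap)
      also have "\<dots> = (\<Sum>i=1..n. of_bool (w i = t))"
      proof (rule sum.cong)
        fix i assume "i \<in> {1..n}"
        then have "(\<Sum>s\<in>F. of_bool ((x i, w i) = (s, t))) = (\<Sum>s\<in>F. if x i = s then of_bool (w i = t) else (0::real))"
          by (intro sum.cong) auto
        with xF \<open>i \<in> {1..n}\<close> show "(\<Sum>s\<in>F. of_bool ((x i, w i) = (s, t))) = (of_bool (w i = t) :: real)"
          using F by simp
      qed simp
      finally show ?thesis .
    qed
    have N0: "N w z = 0" if "\<And>i. i \<in> {1..n} \<Longrightarrow> w i \<noteq> z" for w z
      unfolding N_def using that by (intro sum.neutral) auto
    have N_nonneg: "0 \<le> N w z" for w z
      unfolding N_def by (intro sum_nonneg) auto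
    have N_le: "N w z \<le> real n" for w z
      using sum_bounded_above[of "{1..n}" "\<lambda>i. of_bool (w i = z)" "1::real"] by (simp add: N_def)
    have "0 \<le> \<pi>' z" for z
    proof -
      have "\<epsilon> * N a z \<le> \<pi> z"
      proof (cases "\<exists>i\<in>{1..n}. a i = z")
        case True
        then have "real n * \<epsilon> \<le> \<pi> z"
          using \<epsilon>_le by (auto simp: a_def)
        moreover have "\<epsilon> * N a z \<le> \<epsilon> * real n"
          using N_le \<epsilon> by (intro mult_left_mono) auto
        ultimately show ?thesis
          by (simp add: mult.commute)
      next
        case False
        then have "N a z = 0"
          by (intro N0) auto
        then show ?thesis
          using \<pi>_nonneg by simp
      qed
      moreover have "0 \<le> \<epsilon> * N b z"
        using N_nonneg \<epsilon> by simp
      ultimately show ?thesis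
        unfolding \<pi>'_def right_diff_distrib by linarith
    qed
    moreover have "\<pi>' z = 0" if "z \<notin> F \<times> F" for z
    proof -
      have "N a z = 0" "N b z = 0"
        using that xF yF yF' by (auto intro!: N0 simp: a_def b_def)
      then show ?thesis
        using \<pi>_out that by (simp add: \<pi>'_def)
    qed
    moreover have "(\<Sum>t\<in>F. \<pi>' (s, t)) = p s" if "s \<in> F" for s
      using \<pi>_row that row[of y s] row[of "\<lambda>i. y (Suc i)" s] yF yF'
      by (simp add: \<pi>'_def sum.distrib sum_subtractf a_def[abs_def] b_def[abs_def] flip: sum_distrib_left)
    moreover have "(\<Sum>s\<in>F. \<pi>' (s, t)) = q t" if "t \<in> F" for t
      using \<pi>_col that col[of y t] col[of "\<lambda>i. y (Suc i)" t] shift[of "\<lambda>w. of_bool (w = t)"]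
      by (simp add: \<pi>'_def sum.distrib sum_subtractf a_def[abs_def] b_def[abs_def] flip: sum_distrib_left)
    ultimately have "\<pi>' \<in> Plans"
      unfolding Plans_def by blast
    then have "V \<pi>' \<le> V \<pi>"
      by (rule max)
    have VN: "(\<Sum>z\<in>F\<times>F. N w z * (fst z \<bullet> snd z)) = (\<Sum>i=1..n. fst (w i) \<bullet> snd (w i))"
      if "\<And>i. i \<in> {1..n} \<Longrightarrow> w i \<in> F \<times> F" for w
    proof -
      have "(\<Sum>z\<in>F\<times>F. N w z * (fst z \<bullet> snd z)) = (\<Sum>i=1..n. \<Sum>z\<in>F\<times>F. of_bool (w i = z) * (fst z \<bullet> snd z))"
        unfolding N_def sum_distrib_right by (rule sum.swap)
      also have "\<dots> = (\<Sum>i=1..n. \<Sum>z\<in>F\<times>F. if w i = z then fst z \<bullet> snd z else 0)"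
        by (intro sum.cong) auto
      also have "\<dots> = (\<Sum>i=1..n. fst (w i) \<bullet> snd (w i))"
        using that F by (intro sum.cong) auto
      finally show ?thesis .
    qed
    have "V \<pi>' = V \<pi> + \<epsilon> * ((\<Sum>z\<in>F\<times>F. N b z * (fst z \<bullet> snd z)) - (\<Sum>z\<in>F\<times>F. N a z * (fst z \<bullet> snd z)))"
      by (simp add: V_def \<pi>'_def sum.distrib sum_subtractf sum_distrib_left algebra_simps)
    also have "\<dots> = V \<pi> + \<epsilon> * ((\<Sum>i=1..n. x i \<bullet> y (i + 1)) - (\<Sum>i=1..n. x i \<bullet> y i))"
      using xF yF yF' by (subst (1 2) VN) (auto simp: a_def b_def)
    finally have "\<epsilon> * ((\<Sum>i=1..n. x i \<bullet> y (i + 1)) - (\<Sum>i=1..n. x i \<bullet> y i)) \<le> 0"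
      using \<open>V \<pi>' \<le> V \<pi>\<close> by simp
    then show "(\<Sum>i=1..n. x i \<bullet> y (i + 1)) \<le> (\<Sum>i=1..n. x i \<bullet> y i)"
      using \<epsilon> by (simp add: mult_le_0_iff)
  qed
  with \<pi>_nonneg \<pi>_row \<pi>_col show ?thesis
    by (rule that)
qed

section \<open>Couplings of finite measures that are cyclically monotone up to rounding\<close>

text \<open>
  Push \<open>P\<close> and \<open>Q\<close> forward to the finite range of \<open>f\<close>, take an optimal plan \<open>\<pi>\<close> there, and spread
  \<open>\<pi> (s, t)\<close> over the product of the fibres of \<open>s\<close> and \<open>t\<close> proportionally to \<open>P \<Otimes>\<^sub>M Q\<close>. This
  reproduces the marginals \<open>P\<close> and \<open>Q\<close> exactly, not just those of the rounded measures, which is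
  what survives a limit without any continuity argument.
\<close>

lemma coupling_near_cyclically_monotone:
  fixes P Q :: "'a::{real_inner, second_countable_topology} measure" and f :: "'a \<Rightarrow> 'a"
  assumes "finite_measure P" "finite_measure Q" and sets: "sets P = sets borel" "sets Q = sets borel"
    and mass: "emeasure P UNIV = emeasure Q UNIV"
    and f: "f \<in> borel_measurable borel" "finite (range f)"
  obtains \<gamma> :: "('a \<times> 'a) measure" and S where
    "sets \<gamma> = sets borel"
    "\<And>A. A \<in> sets borel \<Longrightarrow> emeasure \<gamma> (A \<times> UNIV) = emeasure P A"
    "\<And>A. A \<in> sets borel \<Longrightarrow> emeasure \<gamma> (UNIV \<times> A) = emeasure Q A"
    "cyclically_monotone S"
    "\<And>C. C \<in> sets borel \<Longrightarrow> emeasure \<gamma> C > 0 \<Longrightarrow> \<exists>(x, y)\<in>C. (f x, f y) \<in> S"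
proof -
  interpret P: finite_measure P by fact
  interpret Q: finite_measure Q by fact
  define F where "F = range f"
  define fib where "fib s = f -` {s}" for s
  define p where "p s = measure P (fib s)" for s
  define q where "q s = measure Q (fib s)" for s
  have fib[measurable]: "fib s \<in> sets borel" for s
    using measurable_sets[OF f(1), of "{s}"] by (simp add: fib_def)
  have finF: "finite F"
    using f by (simp add: F_def)
  have fibers: "measure M B = (\<Sum>s\<in>F. measure M (fib s \<inter> B))"
    if "finite_measure M" "sets M = sets borel" "B \<in> sets borel" for M B
  proof -
    interpret finite_measure M by fact
    have "measure M (\<Union>s\<in>F. fib s \<inter> B) = (\<Sum>s\<in>F. measure M (fib s \<inter> B))"
    proof (rule finite_measure_finite_Union[OF finF])
      show "(\<lambda>s. fib s \<inter> B) ` F \<subseteq> sets M"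
        unfolding that(2) using fib that(3) by blast
      show "disjoint_family_on (\<lambda>s. fib s \<inter> B) F"
        unfolding disjoint_family_on_def fib_def by blast
    qed
    also have "(\<Union>s\<in>F. fib s \<inter> B) = B"
      by (auto simp: F_def fib_def)
    finally show ?thesis .
  qed
  have "sum p F = sum q F"
    using fibers[of P UNIV] fibers[of Q UNIV] mass sets \<open>finite_measure P\<close> \<open>finite_measure Q\<close>
    by (simp add: p_def q_def measure_def)
  then obtain \<pi> where \<pi>: "\<And>z. 0 \<le> \<pi> z"
    and row: "\<And>s. s \<in> F \<Longrightarrow> (\<Sum>t\<in>F. \<pi> (s, t)) = p s"
    and col: "\<And>t. t \<in> F \<Longrightarrow> (\<Sum>s\<in>F. \<pi> (s, t)) = q t"
    and cm: "cyclically_monotone {z \<in> F \<times> F. 0 < \<pi> z}"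
    using cyclically_monotone_finite_plan[OF finF, of p q] by (auto simp: p_def q_def)
  define c where "c s t = \<pi> (s, t) / (p s * q t)" for s t
  have c: "0 \<le> c s t" for s t
    using \<pi> by (auto simp: c_def p_def q_def)
  \<comment> \<open>Where a fibre is null the quotient \<open>c\<close> is \<open>0\<close> by convention; this is harmless because the
      plan vanishes there as well.\<close>
  have p0: "\<pi> (s, t) = 0" if "s \<in> F" "t \<in> F" "p s = 0" for s t
    using row[of s] that finF \<pi> by (simp add: sum_nonneg_eq_0_iff)
  have q0: "\<pi> (s, t) = 0" if "s \<in> F" "t \<in> F" "q t = 0" for s t
    using col[of t] that finF \<pi> by (simp add: sum_nonneg_eq_0_iff)
  have sum1: "(\<Sum>s\<in>F. \<Sum>t\<in>F. c s t * (r s * q t)) = (\<Sum>s\<in>F. r s)"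
    if r: "\<And>s. p s = 0 \<Longrightarrow> r s = 0" for r
  proof (rule sum.cong)
    fix s assume s: "s \<in> F"
    have "(\<Sum>t\<in>F. c s t * (r s * q t)) = (\<Sum>t\<in>F. r s / p s * \<pi> (s, t))"
      using q0 s by (intro sum.cong) (auto simp: c_def)
    also have "\<dots> = r s / p s * p s"
      unfolding row[OF s, symmetric] sum_distrib_left ..
    also have "\<dots> = r s"
      using r by auto
    finally show "(\<Sum>t\<in>F. c s t * (r s * q t)) = r s" .
  qed simp
  have sum2: "(\<Sum>s\<in>F. \<Sum>t\<in>F. c s t * (p s * r t)) = (\<Sum>t\<in>F. r t)"
    if r: "\<And>s. q s = 0 \<Longrightarrow> r s = 0" for r
  proof (subst sum.swap, rule sum.cong)
    fix t assume t: "t \<in> F"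
    have "(\<Sum>s\<in>F. c s t * (p s * r t)) = (\<Sum>s\<in>F. r t / q t * \<pi> (s, t))"
      using p0 t by (intro sum.cong) (auto simp: c_def)
    also have "\<dots> = r t / q t * q t"
      unfolding col[OF t, symmetric] sum_distrib_left ..
    also have "\<dots> = r t"
      using r by auto
    finally show "(\<Sum>s\<in>F. c s t * (p s * r t)) = r t" .
  qed simp
  define h where "h z = (\<Sum>s\<in>F. \<Sum>t\<in>F. ennreal (c s t) * indicator (fib s \<times> fib t) z)" for z
  define \<gamma> where "\<gamma> = density (P \<Otimes>\<^sub>M Q) h"
  have sPQ: "sets (P \<Otimes>\<^sub>M Q) = sets borel"
    using sets_pair_measure_cong[OF sets] unfolding borel_prod .
  have rect[measurable]: "fib s \<times> fib t \<in> sets (P \<Otimes>\<^sub>M Q)" for s t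
    using fib sets by (intro pair_measureI) auto
  have \<gamma>_eq: "emeasure \<gamma> C = (\<Sum>s\<in>F. \<Sum>t\<in>F. ennreal (c s t) * emeasure (P \<Otimes>\<^sub>M Q) (fib s \<times> fib t \<inter> C))"
    if "C \<in> sets borel" for C
  proof -
    have C[measurable]: "C \<in> sets (P \<Otimes>\<^sub>M Q)"
      using that sPQ by simp
    have "emeasure \<gamma> C = (\<integral>\<^sup>+z. h z * indicator C z \<partial>(P \<Otimes>\<^sub>M Q))"
      unfolding \<gamma>_def h_def by (rule emeasure_density) auto
    also have "\<dots> = (\<integral>\<^sup>+z. (\<Sum>s\<in>F. \<Sum>t\<in>F. ennreal (c s t) * indicator (fib s \<times> fib t \<inter> C) z) \<partial>(P \<Otimes>\<^sub>M Q))"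
      by (intro nn_integral_cong) (simp add: h_def sum_distrib_right indicator_inter_arith mult.assoc)
    also have "\<dots> = (\<Sum>s\<in>F. \<Sum>t\<in>F. ennreal (c s t) * emeasure (P \<Otimes>\<^sub>M Q) (fib s \<times> fib t \<inter> C))"
      by (simp add: nn_integral_sum nn_integral_cmult_indicator)
    finally show ?thesis .
  qed
  have rect_eq: "emeasure \<gamma> (A \<times> B) = ennreal (\<Sum>s\<in>F. \<Sum>t\<in>F. c s t * (measure P (fib s \<inter> A) * measure Q (fib t \<inter> B)))"
    if "A \<in> sets borel" "B \<in> sets borel" for A B
  proof -
    have "A \<times> B \<in> sets borel"
      using that by (rule borel_Times)
    moreover have "emeasure (P \<Otimes>\<^sub>M Q) (fib s \<times> fib t \<inter> A \<times> B)
        = ennreal (measure P (fib s \<inter> A) * measure Q (fib t \<inter> B))" for s t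
      using that sets
      by (simp add: Times_Int_Times Q.emeasure_pair_measure_Times P.emeasure_eq_measure Q.emeasure_eq_measure ennreal_mult)
    ultimately show ?thesis
      using c by (simp add: \<gamma>_eq sum_nonneg flip: ennreal_mult)
  qed
  show ?thesis
  proof (rule that[of \<gamma> "{z \<in> F \<times> F. 0 < \<pi> z}"])
    show "sets \<gamma> = sets borel"
      using sPQ by (simp add: \<gamma>_def)
    show "emeasure \<gamma> (A \<times> UNIV) = emeasure P A" if A: "A \<in> sets borel" for A
    proof -
      have "measure P (fib s \<inter> A) = 0" if "p s = 0" for s
        using P.finite_measure_mono[of "fib s \<inter> A" "fib s"] that sets by (simp add: p_def measure_le_0_iff)
      then have "emeasure \<gamma> (A \<times> UNIV) = ennreal (\<Sum>s\<in>F. measure P (fib s \<inter> A))"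
        using A sum1[of "\<lambda>s. measure P (fib s \<inter> A)"] by (simp add: rect_eq q_def)
      then show ?thesis
        using fibers[of P A] A sets \<open>finite_measure P\<close> by (simp add: P.emeasure_eq_measure)
    qed
    show "emeasure \<gamma> (UNIV \<times> A) = emeasure Q A" if A: "A \<in> sets borel" for A
    proof -
      have "measure Q (fib s \<inter> A) = 0" if "q s = 0" for s
        using Q.finite_measure_mono[of "fib s \<inter> A" "fib s"] that sets by (simp add: q_def measure_le_0_iff)
      then have "emeasure \<gamma> (UNIV \<times> A) = ennreal (\<Sum>s\<in>F. measure Q (fib s \<inter> A))"
        using A sum2[of "\<lambda>s. measure Q (fib s \<inter> A)"] by (simp add: rect_eq p_def)
      then show ?thesis
        using fibers[of Q A] A sets \<open>finite_measure Q\<close> by (simp add: Q.emeasure_eq_measure)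
    qed
    show "\<exists>(x, y)\<in>C. (f x, f y) \<in> {z \<in> F \<times> F. 0 < \<pi> z}" if C: "C \<in> sets borel" "emeasure \<gamma> C > 0" for C
    proof -
      have "\<exists>s\<in>F. \<exists>t\<in>F. ennreal (c s t) * emeasure (P \<Otimes>\<^sub>M Q) (fib s \<times> fib t \<inter> C) \<noteq> 0"
      proof (rule ccontr)
        assume "\<not> ?thesis"
        then have "emeasure \<gamma> C = 0"
          unfolding \<gamma>_eq[OF C(1)] by (intro sum.neutral ballI) blast
        with C show False
          by simp
      qed
      then obtain s t where st: "s \<in> F" "t \<in> F"
        "ennreal (c s t) * emeasure (P \<Otimes>\<^sub>M Q) (fib s \<times> fib t \<inter> C) \<noteq> 0"
        by blast
      then have "fib s \<times> fib t \<inter> C \<noteq> {}" "\<pi> (s, t) \<noteq> 0"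
        by (auto simp: c_def)
      with st \<pi>[of "(s, t)"] show ?thesis
        by (force simp: fib_def)
    qed
  qed (rule cm)
qed

section \<open>Regularity of measures that are finite away from the origin\<close>

lemma sets_punctured_borel: "A \<in> sets punctured_borel \<longleftrightarrow> A \<in> sets borel \<and> 0 \<notin> A"
  by (subst sets_restrict_space_iff) auto

lemma sets_M0: "\<mu> \<in> M0 \<Longrightarrow> A \<in> sets \<mu> \<longleftrightarrow> A \<in> sets borel \<and> 0 \<notin> A"
  by (auto simp: M0_def sets_punctured_borel)

lemma emeasure_M0_finite:
  assumes "\<mu> \<in> M0" "A \<in> sets borel" "0 \<notin> closure A"
  shows "emeasure \<mu> A < \<infinity>"
  using assms closure_subset[of A] unfolding M0_def by (fastforce simp: sets_punctured_borel)

lemma zero_notin_closure_diff_ball: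
  "0 < r \<Longrightarrow> 0 \<notin> closure (A - ball (0::'a::real_normed_vector) r)"
proof -
  assume "0 < r"
  moreover have "closure (A - ball 0 r) \<subseteq> - ball 0 r"
    by (intro closure_minimal) auto
  ultimately show ?thesis
    by auto
qed

text \<open>
  The measure \<open>\<mu>\<close> outside the ball of radius \<open>r\<close>, as a measure on the whole space, plus an atom of mass
  \<open>c\<close> at the origin. The atom allows two truncations to be given the same total mass.
\<close>

definition truncated_measure :: "'a::real_normed_vector measure \<Rightarrow> real \<Rightarrow> ennreal \<Rightarrow> 'a measure" where
  "truncated_measure \<mu> r c =
     measure_of UNIV (sets borel) (\<lambda>A. emeasure \<mu> (A - ball 0 r) + c * indicator A 0)"

lemma sets_truncated_measure[simp]: "sets (truncated_measure \<mu> r c) = sets borel"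
  unfolding truncated_measure_def using sets.sets_measure_of_eq[of borel] by simp

lemma emeasure_truncated_measure:
  fixes \<mu> :: "'a::real_normed_vector measure"
  assumes \<mu>: "\<mu> \<in> M0" and r: "0 < r" and A: "A \<in> sets borel"
  shows "emeasure (truncated_measure \<mu> r c) A = emeasure \<mu> (A - ball 0 r) + c * indicator A 0"
  unfolding truncated_measure_def
proof (rule emeasure_measure_of_sigma)
  show "sigma_algebra UNIV (sets (borel :: 'a measure))"
    using sets.sigma_algebra_axioms[of "borel :: 'a measure"] by simp
  show "countably_additive (sets borel) (\<lambda>A. emeasure \<mu> (A - ball 0 r) + c * indicator A 0)"
  proof (rule countably_additiveI)
    fix B :: "nat \<Rightarrow> 'a set"
    assume B: "range B \<subseteq> sets borel" "disjoint_family B" "(\<Union>i. B i) \<in> sets borel"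
    have "(\<Sum>i. emeasure \<mu> (B i - ball 0 r)) = emeasure \<mu> (\<Union>i. B i - ball 0 r)"
    proof (rule suminf_emeasure)
      show "range (\<lambda>i. B i - ball 0 r) \<subseteq> sets \<mu>"
        using B(1) r by (auto simp: sets_M0[OF \<mu>])
      show "disjoint_family (\<lambda>i. B i - ball 0 r)"
        using B(2) unfolding disjoint_family_on_def by blast
    qed
    also have "(\<Union>i. B i - ball 0 r) = (\<Union>i. B i) - ball 0 r"
      by auto
    finally have 1: "(\<Sum>i. emeasure \<mu> (B i - ball 0 r)) = emeasure \<mu> ((\<Union>i. B i) - ball 0 r)" .
    have 2: "(\<Sum>i. c * indicator (B i) 0) = c * indicator (\<Union>i. B i) 0"
      unfolding ennreal_suminf_cmult suminf_indicator[OF B(2)] ..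
    show "(\<Sum>i. emeasure \<mu> (B i - ball 0 r) + c * indicator (B i) 0) =
        emeasure \<mu> ((\<Union>i. B i) - ball 0 r) + c * indicator (\<Union>i. B i) 0"
      by (subst suminf_add[symmetric]) (simp_all only: 1 2 summableI)
  qed
qed (use A in \<open>auto simp: positive_def\<close>)

lemma finite_measure_truncated_measure:
  assumes "\<mu> \<in> M0" "0 < r" "c < \<infinity>"
  shows "finite_measure (truncated_measure \<mu> r c)"
proof
  have "space (truncated_measure \<mu> r c) = UNIV"
    using sets_eq_imp_space_eq[OF sets_truncated_measure] by simp
  moreover have "emeasure \<mu> (UNIV - ball 0 r) < \<infinity>"
    using assms zero_notin_closure_diff_ball by (intro emeasure_M0_finite) auto
  ultimately show "emeasure (truncated_measure \<mu> r c) (space (truncated_measure \<mu> r c)) \<noteq> \<infinity>"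
    using assms by (simp add: emeasure_truncated_measure less_top[symmetric])
qed

lemma compact_inner_approximation:
  fixes P :: "'a::{second_countable_topology, complete_space} measure"
  assumes "finite_measure P" and sP: "sets P = sets borel" and A: "A \<in> sets borel" and e: "0 < (e::real)"
  obtains K where "compact K" "K \<subseteq> A" "emeasure P (A - K) \<le> ennreal e"
proof (cases "emeasure P A = 0")
  case True
  then show ?thesis
    using that[of "{}"] by simp
next
  case False
  interpret finite_measure P by fact
  have "emeasure P A - ennreal e < emeasure P A"
    using False e by (intro ennreal_between) (auto simp: zero_less_iff_neq_zero less_top[symmetric])
  also have "emeasure P A = (SUP K \<in> {K. K \<subseteq> A \<and> compact K}. emeasure P K)"
    using sP A by (intro inner_regular) auto
  finally obtain K where K: "K \<subseteq> A" "compact K" "emeasure P A - ennreal e < emeasure P K"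
    by (auto simp: less_SUP_iff)
  then have [simp]: "K \<in> sets P"
    using sP by (auto intro: borel_compact)
  have "emeasure P (A - K) = emeasure P A - emeasure P K"
    using K A sP by (intro emeasure_Diff) auto
  also have "\<dots> \<le> ennreal e"
    using K(3) by (simp add: ennreal_minus_le_iff) (metis add.commute ennreal_minus_le_iff less_imp_le)
  finally show ?thesis
    using K that by blast
qed

lemma open_outer_approximation:
  fixes P :: "'a::{second_countable_topology, complete_space} measure"
  assumes "finite_measure P" and sP: "sets P = sets borel" and A: "A \<in> sets borel" and e: "0 < (e::real)"
  obtains U where "open U" "A \<subseteq> U" "emeasure P (U - A) \<le> ennreal e"
proof -
  interpret finite_measure P by fact
  have "(INF U \<in> {U. A \<subseteq> U \<and> open U}. emeasure P U) = emeasure P A"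
    using sP A by (intro outer_regular[symmetric]) auto
  also have "\<dots> < emeasure P A + ennreal e"
    using e by (simp add: emeasure_eq_measure ennreal_less_iff flip: ennreal_plus)
  finally obtain U where U: "A \<subseteq> U" "open U" "emeasure P U < emeasure P A + ennreal e"
    by (auto simp: INF_less_iff)
  have "emeasure P (U - A) = emeasure P U - emeasure P A"
    using U A sP by (intro emeasure_Diff) auto
  also have "\<dots> \<le> ennreal e"
    using U(3) by (simp add: ennreal_minus_le_iff less_imp_le)
  finally show ?thesis
    using U that by blast
qed

lemma cball_inside_or_outside:
  fixes A :: "'a::metric_space set"
  assumes "x \<notin> frontier A"
  obtains s where "s > 0" "cball x s \<subseteq> A \<or> cball x s \<subseteq> - A"
proof -
  have "x \<in> interior A \<or> x \<in> interior (- A)"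
    using assms by (auto simp: frontier_def interior_complement)
  then show ?thesis
    by (meson mem_interior_cball that)
qed

text \<open>
  Regularity of finite measures applies to the part of \<open>A\<close> outside a small ball around \<open>0\<close>. As \<open>0\<close>
  is not on the boundary of \<open>A\<close>, the ball can be chosen either disjoint from \<open>A\<close>, or inside \<open>A\<close>, in
  which case the compact set may swallow it; either way the error avoids the ball.
\<close>

lemma M0_inner_regular:
  fixes \<mu> :: "'a::euclidean_space measure"
  assumes \<mu>: "\<mu> \<in> M0" and A: "A \<in> sets borel" and fr: "0 \<notin> frontier A" and e: "0 < (e::real)"
  obtains K where "compact K" "K \<subseteq> A" "0 \<notin> closure (A - K)" "emeasure \<mu> (A - K) \<le> ennreal e"
proof -
  obtain s where s: "s > 0" "cball 0 s \<subseteq> A \<or> cball 0 s \<subseteq> - A"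
    using cball_inside_or_outside[OF fr] .
  define P where "P = truncated_measure \<mu> s 0"
  have P: "emeasure P B = emeasure \<mu> (B - ball 0 s)" if "B \<in> sets borel" for B
    using that by (simp add: P_def emeasure_truncated_measure[OF \<mu> s(1)])
  interpret P: finite_measure P
    unfolding P_def using \<mu> s by (intro finite_measure_truncated_measure) auto
  have sP: "sets P = sets borel"
    by (simp add: P_def)
  obtain K' where K': "compact K'" "K' \<subseteq> A - ball 0 s" "emeasure P (A - ball 0 s - K') \<le> ennreal e"
    using compact_inner_approximation[OF P.finite_measure_axioms sP _ e, of "A - ball 0 s"] A by auto
  define K where "K = K' \<union> (if cball 0 s \<subseteq> A then cball 0 s else {})"
  have K: "compact K" "K \<subseteq> A"
    using K' by (auto simp: K_def split: if_splits)
  have [measurable]: "K \<in> sets borel" "K' \<in> sets borel"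
    using K K' by (auto intro: borel_compact)
  have AK: "A - K \<subseteq> A - ball 0 s - K'"
    using s by (auto simp: K_def subset_eq split: if_splits)
  then have AK': "A - K - ball 0 s = A - K"
    by blast
  have "emeasure \<mu> (A - K) = emeasure P (A - K)"
    using A by (simp add: P AK')
  also have "\<dots> \<le> emeasure P (A - ball 0 s - K')"
    using AK A sP by (intro emeasure_mono) auto
  finally have "emeasure \<mu> (A - K) \<le> ennreal e"
    using K'(3) by simp
  moreover have "0 \<notin> closure (A - K)"
    using zero_notin_closure_diff_ball[OF s(1), of "A - K"] AK' by simp
  ultimately show ?thesis
    using that K by blast
qed

text \<open>
  As for inner approximation: an open superset is corrected on a small ball around \<open>0\<close>, which it keeps if
  \<open>A\<close> contains that ball and loses otherwise.
\<close>

lemma M0_outer_regular: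
  fixes \<mu> :: "'a::euclidean_space measure"
  assumes \<mu>: "\<mu> \<in> M0" and A: "A \<in> sets borel" and fr: "0 \<notin> frontier A" and e: "0 < (e::real)"
  obtains U where "open U" "A \<subseteq> U" "0 \<notin> closure (U - A)" "emeasure \<mu> (U - A) \<le> ennreal e"
proof -
  obtain s where s: "s > 0" "cball 0 s \<subseteq> A \<or> cball 0 s \<subseteq> - A"
    using cball_inside_or_outside[OF fr] .
  define P where "P = truncated_measure \<mu> s 0"
  have P: "emeasure P B = emeasure \<mu> (B - ball 0 s)" if "B \<in> sets borel" for B
    using that by (simp add: P_def emeasure_truncated_measure[OF \<mu> s(1)])
  interpret P: finite_measure P
    unfolding P_def using \<mu> s by (intro finite_measure_truncated_measure) auto
  have sP: "sets P = sets borel"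
    by (simp add: P_def)
  obtain U' where U': "open U'" "A \<subseteq> U'" "emeasure P (U' - A) \<le> ennreal e"
    using open_outer_approximation[OF P.finite_measure_axioms sP A e] .
  define U where "U = (if cball 0 s \<subseteq> A then U' else U' - cball 0 s)"
  have U: "open U" "A \<subseteq> U"
    using U' s by (auto simp: U_def)
  have UA: "U - A \<subseteq> U' - A"
    by (auto simp: U_def)
  have UA': "U - A - ball 0 s = U - A"
    by (auto simp: U_def subset_eq split: if_splits)
  have "emeasure \<mu> (U - A) = emeasure P (U - A)"
    using A U by (simp add: P UA')
  also have "\<dots> \<le> emeasure P (U' - A)"
    using UA U' A sP by (intro emeasure_mono) auto
  finally have "emeasure \<mu> (U - A) \<le> ennreal e"
    using U'(3) by simp
  moreover have "0 \<notin> closure (U - A)"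
    using zero_notin_closure_diff_ball[OF s(1), of "U - A"] UA' by simp
  ultimately show ?thesis
    using that U by blast
qed

section \<open>A semiring of rectangles generating the punctured Borel sets\<close>

text \<open>
  Excluding \<open>0\<close> from the boundary of the sides forbids rectangles such as \<open>A \<times> {0}\<close> and
  \<open>A \<times> (ball 0 1 - {0})\<close>, between which mass can leak in a limit when the second marginal is infinite near
  \<open>0\<close>. The last condition keeps the rectangles away from the origin of the product space.
\<close>

definition rectangles0 :: "('a::real_normed_vector \<times> 'a) set set" where
  "rectangles0 = {A \<times> B | A B. A \<in> sets borel \<and> B \<in> sets borel \<and>
     0 \<notin> frontier A \<and> 0 \<notin> frontier B \<and> (0 \<notin> A \<or> 0 \<notin> B)}"

lemma zero_notin_frontier_Int:
  "0 \<notin> frontier A \<Longrightarrow> 0 \<notin> frontier B \<Longrightarrow> 0 \<notin> frontier (A \<inter> B)"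
  using frontier_Int_subset[of A B] by blast

lemma zero_notin_frontier_Diff:
  "0 \<notin> frontier A \<Longrightarrow> 0 \<notin> frontier B \<Longrightarrow> 0 \<notin> frontier (A - B)"
  using zero_notin_frontier_Int[of A "- B"] by (simp add: Diff_eq)

lemma rectangles0I:
  "A \<in> sets borel \<Longrightarrow> B \<in> sets borel \<Longrightarrow> 0 \<notin> frontier A \<Longrightarrow> 0 \<notin> frontier B \<Longrightarrow>
    0 \<notin> A \<or> 0 \<notin> B \<Longrightarrow> A \<times> B \<in> rectangles0"
  unfolding rectangles0_def by blast

lemma rectangles0_borel: "R \<in> rectangles0 \<Longrightarrow> R \<in> sets borel"
  for R :: "('a::{real_normed_vector, second_countable_topology} \<times> 'a) set"
  by (auto simp: rectangles0_def intro: borel_Times)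

lemma zero_notin_rectangles0: "R \<in> rectangles0 \<Longrightarrow> 0 \<notin> R"
  by (auto simp: rectangles0_def zero_prod_def)

lemma semiring_rectangles0: "semiring_of_sets (- {0}) (rectangles0 :: ('a::real_normed_vector \<times> 'a) set set)"
proof
  show "rectangles0 \<subseteq> Pow (- {0 :: 'a \<times> 'a})"
    by (auto simp: rectangles0_def zero_prod_def)
  show "{} \<in> (rectangles0 :: ('a \<times> 'a) set set)"
    by (auto simp: rectangles0_def intro!: exI[where x="{}"])
  fix R R' :: "('a \<times> 'a) set"
  assume "R \<in> rectangles0" "R' \<in> rectangles0"
  then obtain A B A' B' where R: "R = A \<times> B" "R' = A' \<times> B'"
    and meas: "A \<in> sets borel" "B \<in> sets borel" "A' \<in> sets borel" "B' \<in> sets borel"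
    and fr: "0 \<notin> frontier A" "0 \<notin> frontier B" "0 \<notin> frontier A'" "0 \<notin> frontier B'"
    and 0: "0 \<notin> A \<or> 0 \<notin> B" "0 \<notin> A' \<or> 0 \<notin> B'"
    unfolding rectangles0_def by blast
  have "(A \<inter> A') \<times> (B \<inter> B') \<in> rectangles0"
    using meas fr 0 by (intro rectangles0I zero_notin_frontier_Int) auto
  then show "R \<inter> R' \<in> rectangles0"
    by (simp add: R Times_Int_Times)
  have "(A - A') \<times> B \<in> rectangles0" "(A \<inter> A') \<times> (B - B') \<in> rectangles0"
    using meas fr 0 by (intro rectangles0I zero_notin_frontier_Int zero_notin_frontier_Diff; auto)+
  moreover have "disjoint {(A - A') \<times> B, (A \<inter> A') \<times> (B - B')}"
    by (auto simp: disjoint_def)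
  moreover have "R - R' = \<Union>{(A - A') \<times> B, (A \<inter> A') \<times> (B - B')}"
    by (auto simp: R)
  ultimately show "\<exists>C\<subseteq>rectangles0. finite C \<and> disjoint C \<and> R - R' = \<Union>C"
    by (intro exI[of _ "{(A - A') \<times> B, (A \<inter> A') \<times> (B - B')}"]) auto
qed

text \<open>
  A coordinate of \<open>p\<close> that is nonzero gets a neighbourhood staying away from \<open>0\<close>; a zero coordinate gets
  any open neighbourhood, which has \<open>0\<close> in its interior. As \<open>p \<noteq> 0\<close>, the former happens at least once.
\<close>

lemma small_rectangle0:
  fixes p :: "'a::real_normed_vector \<times> 'a"
  assumes W: "open W" "p \<in> W" "p \<noteq> 0"
  shows "\<exists>R\<in>rectangles0. open R \<and> p \<in> R \<and> R \<subseteq> W"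
proof -
  have small: "\<exists>U. open U \<and> x \<in> U \<and> U \<subseteq> V \<and> 0 \<notin> frontier U \<and> (x \<noteq> 0 \<longrightarrow> 0 \<notin> U)"
    if V: "open V" "x \<in> V" for V and x :: 'a
  proof (cases "x = 0")
    case True
    then show ?thesis
      using V by (intro exI[of _ V]) (auto simp: frontier_def interior_open)
  next
    case False
    define U where "U = V \<inter> ball x (norm x / 2)"
    have "closure U \<subseteq> cball x (norm x / 2)"
      by (rule closure_minimal) (auto simp: U_def)
    with False have "0 \<notin> closure U"
      by (auto simp: dist_norm)
    with closure_subset[of U] show ?thesis
      using V False by (intro exI[of _ U]) (auto simp: U_def frontier_def)
  qed
  obtain U V where UV: "open U" "open V" "p \<in> U \<times> V" "U \<times> V \<subseteq> W"
    using W open_prod_def by (metis openE open_prod_elim)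
  obtain U' V' where U': "open U'" "fst p \<in> U'" "U' \<subseteq> U" "0 \<notin> frontier U'" "fst p \<noteq> 0 \<longrightarrow> 0 \<notin> U'"
    and V': "open V'" "snd p \<in> V'" "V' \<subseteq> V" "0 \<notin> frontier V'" "snd p \<noteq> 0 \<longrightarrow> 0 \<notin> V'"
    using small[of U "fst p"] small[of V "snd p"] UV by (metis mem_Times_iff)
  have "U' \<times> V' \<in> rectangles0"
    using U' V' W(3) by (intro rectangles0I) (auto simp: prod_eq_iff)
  with U' V' UV show ?thesis
    by (intro bexI[of _ "U' \<times> V'"]) (auto simp: mem_Times_iff open_Times)
qed

lemma open_Union_rectangles0:
  fixes W :: "('a::{real_normed_vector, second_countable_topology} \<times> 'a) set"
  assumes "open W"
  obtains \<C> where "countable \<C>" "\<C> \<subseteq> rectangles0" "\<Union>\<C> = W - {0}" "\<And>R. R \<in> \<C> \<Longrightarrow> open R"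
proof -
  define \<R> where "\<R> = {R \<in> rectangles0. open R \<and> R \<subseteq> W}"
  obtain \<C> where \<C>: "\<C> \<subseteq> \<R>" "countable \<C>" "\<Union>\<C> = \<Union>\<R>"
    using Lindelof[of \<R>] by (auto simp: \<R>_def)
  have "\<Union>\<R> \<subseteq> W - {0}"
    by (auto simp: \<R>_def rectangles0_def zero_prod_def)
  moreover have "W - {0} \<subseteq> \<Union>\<R>"
  proof
    fix p assume "p \<in> W - {0}"
    then obtain R where "R \<in> rectangles0" "open R" "p \<in> R" "R \<subseteq> W"
      using small_rectangle0[OF assms] by blast
    then show "p \<in> \<Union>\<R>"
      unfolding \<R>_def by blast
  qed
  ultimately show ?thesis
    using \<C> by (intro that[of \<C>]) (auto simp: \<R>_def)
qed

lemma sigma_sets_rectangles0: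
  "sigma_sets (- {0}) rectangles0 =
     sets (punctured_borel :: ('a::{real_normed_vector, second_countable_topology} \<times> 'a) measure)"
proof
  have Pow: "(rectangles0 :: ('a \<times> 'a) set set) \<subseteq> Pow (- {0})"
    using zero_notin_rectangles0 by blast
  have "R \<in> sets punctured_borel" if "R \<in> rectangles0" for R :: "('a \<times> 'a) set"
    using rectangles0_borel[OF that] zero_notin_rectangles0[OF that] by (simp only: sets_punctured_borel simp_thms)
  then have "rectangles0 \<subseteq> sets (punctured_borel :: ('a \<times> 'a) measure)"
    by (rule subsetI)
  then have "sigma_sets (space punctured_borel) rectangles0 \<subseteq> sets (punctured_borel :: ('a \<times> 'a) measure)"
    by (rule sets.sigma_sets_subset)
  then show "sigma_sets (- {0}) rectangles0 \<subseteq> sets (punctured_borel :: ('a \<times> 'a) measure)"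
    by (simp add: space_restrict_space)
  define N where "N = sigma (- {0 :: 'a \<times> 'a}) rectangles0"
  have N: "sets N = sigma_sets (- {0}) rectangles0" "space N = - {0}"
    using Pow by (simp_all add: N_def)
  have "(\<lambda>z. z) \<in> borel_measurable N"
  proof (rule borel_measurableI)
    fix W :: "('a \<times> 'a) set"
    assume "open W"
    then obtain \<C> where \<C>: "countable \<C>" "\<C> \<subseteq> rectangles0" "\<Union>\<C> = W - {0}"
      by (rule open_Union_rectangles0)
    moreover have "\<C> \<subseteq> sets N"
      using \<open>\<C> \<subseteq> rectangles0\<close> by (auto simp: N(1) intro: sigma_sets.Basic)
    ultimately have "W - {0} \<in> sets N"
      using sets.countable_Union[of \<C> N] by simp
    then show "(\<lambda>z. z) -` W \<inter> space N \<in> sets N"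
      by (simp add: N(2) Diff_eq)
  qed
  then have id: "(\<lambda>z. z) -` A \<inter> space N \<in> sets N" if "A \<in> sets borel" for A
    using that by (rule measurable_sets)
  show "sets (punctured_borel :: ('a \<times> 'a) measure) \<subseteq> sigma_sets (- {0}) rectangles0"
  proof
    fix A :: "('a \<times> 'a) set" assume "A \<in> sets punctured_borel"
    then have A: "A \<in> sets borel" "0 \<notin> A"
      unfolding sets_punctured_borel by auto
    then have "(\<lambda>z. z) -` A \<inter> space N = A"
      unfolding N(2) by blast
    with id[OF A(1)] show "A \<in> sigma_sets (- {0}) rectangles0"
      by (simp add: N(1))
  qed
qed

section \<open>From additive set functions with good marginals to measures\<close>

text \<open>
  Only countable subadditivity on rectangles is at stake. Shrink \<open>A \<times> B\<close> to a compact rectangle and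
  enlarge each \<open>R i\<close> to an open one. The sets lost or gained lie in strips \<open>D \<times> UNIV\<close> or
  \<open>UNIV \<times> D\<close> with \<open>D\<close> away from \<open>0\<close>, where \<open>\<beta>\<close> is bounded by \<open>\<mu>\<close> or \<open>\<nu>\<close>. A finite subcover of the
  compact rectangle then reduces the claim to finite subadditivity.
\<close>

lemma measure_extending_content:
  fixes \<mu> \<nu> :: "'a::euclidean_space measure" and \<beta> :: "('a \<times> 'a) set \<Rightarrow> ennreal"
  assumes M0: "\<mu> \<in> M0" "\<nu> \<in> M0"
    and pos: "positive (sets borel) \<beta>" and add: "additive (sets borel) \<beta>"
    and marg1: "\<And>A. A \<in> sets borel \<Longrightarrow> 0 \<notin> closure A \<Longrightarrow> \<beta> (A \<times> UNIV) = emeasure \<mu> A"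
    and marg2: "\<And>A. A \<in> sets borel \<Longrightarrow> 0 \<notin> closure A \<Longrightarrow> \<beta> (UNIV \<times> A) = emeasure \<nu> A"
  obtains \<gamma> where "sets \<gamma> = sets punctured_borel" "\<forall>R\<in>rectangles0. emeasure \<gamma> R = \<beta> R"
proof -
  have mono: "\<beta> A \<le> \<beta> B" if "A \<subseteq> B" "A \<in> sets borel" "B \<in> sets borel" for A B
    using sets.additive_increasing[OF pos add] that by (simp add: increasing_def)
  have sub: "\<beta> (\<Union>i\<in>S. A i) \<le> (\<Sum>i\<in>S. \<beta> (A i))"
    if "finite S" "\<And>i. i \<in> S \<Longrightarrow> A i \<in> sets borel" for S :: "nat set" and A
    using sets.subadditive[OF pos add, of A S] that by blast
  have sub2: "\<beta> (A \<union> B) \<le> \<beta> A + \<beta> B" if "A \<in> sets borel" "B \<in> sets borel" for A B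
    using sub[of "{0, 1}" "\<lambda>i. if i = 0 then A else B"] that by (auto simp: Un_commute)
  have sub3: "\<beta> D \<le> \<beta> A + (\<beta> B + \<beta> C)"
    if "D \<subseteq> A \<union> (B \<union> C)" "A \<in> sets borel" "B \<in> sets borel" "C \<in> sets borel" "D \<in> sets borel" for A B C D
  proof -
    have "\<beta> D \<le> \<beta> (A \<union> (B \<union> C))"
      using that by (intro mono) auto
    also have "\<dots> \<le> \<beta> A + \<beta> (B \<union> C)"
      using that by (intro sub2) auto
    also have "\<dots> \<le> \<beta> A + (\<beta> B + \<beta> C)"
      using that by (intro add_left_mono sub2) auto
    finally show ?thesis .
  qed
  have ca: "countably_additive rectangles0 \<beta>"
  proof (rule countably_additiveI)
    fix R :: "nat \<Rightarrow> ('a \<times> 'a) set"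
    assume R: "range R \<subseteq> rectangles0" and disj: "disjoint_family R" and un: "(\<Union>i. R i) \<in> rectangles0"
    have R_borel: "R i \<in> sets borel" for i
      using R by (intro rectangles0_borel) auto
    have U_borel: "(\<Union>i. R i) \<in> sets borel"
      using un by (rule rectangles0_borel)
    have "(\<Sum>i. \<beta> (R i)) \<le> \<beta> (\<Union>i. R i)"
    proof (rule suminf_le_const)
      fix n
      have "(\<Sum>i<n. \<beta> (R i)) = \<beta> (\<Union>i<n. R i)"
        using R_borel disj by (intro sets.additive_sum[OF pos add]) (auto simp: disjoint_family_on_def)
      also have "\<dots> \<le> \<beta> (\<Union>i. R i)"
        using R_borel U_borel by (intro mono) auto
      finally show "(\<Sum>i<n. \<beta> (R i)) \<le> \<beta> (\<Union>i. R i)" .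
    qed simp
    moreover have "\<beta> (\<Union>i. R i) \<le> (\<Sum>i. \<beta> (R i))"
    proof (rule ennreal_le_epsilon)
      fix e :: real assume e: "0 < e"
      \<comment> \<open>Each \<open>R i\<close> is enlarged in two strips of size \<open>d i\<close>; these add up to \<open>e / 2\<close>, and
          shrinking \<open>A \<times> B\<close> costs the other \<open>e / 2\<close>.\<close>
      define d where "d i = e / 4 * (1 / 2) ^ Suc i" for i
      have d: "0 < d i" for i
        using e by (simp add: d_def)
      have e4: "0 < e / 4"
        using e by simp
      obtain A B where AB: "(\<Union>i. R i) = A \<times> B" "A \<in> sets borel" "B \<in> sets borel"
        "0 \<notin> frontier A" "0 \<notin> frontier B"
        using un unfolding rectangles0_def by blast
      obtain K where K: "compact K" "K \<subseteq> A" "0 \<notin> closure (A - K)" "emeasure \<mu> (A - K) \<le> ennreal (e / 4)"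
        by (rule M0_inner_regular[OF M0(1) AB(2,4) e4])
      obtain L where L: "compact L" "L \<subseteq> B" "0 \<notin> closure (B - L)" "emeasure \<nu> (B - L) \<le> ennreal (e / 4)"
        by (rule M0_inner_regular[OF M0(2) AB(3,5) e4])
      have KL_borel: "K \<in> sets borel" "L \<in> sets borel"
        using K L by (auto intro: borel_compact)
      have "\<beta> (A \<times> B) \<le> \<beta> (K \<times> L) + (\<beta> ((A - K) \<times> UNIV) + \<beta> (UNIV \<times> (B - L)))"
        using AB KL_borel by (intro sub3) (auto intro!: borel_Times)
      also have "\<dots> \<le> \<beta> (K \<times> L) + (ennreal (e / 4) + ennreal (e / 4))"
        using K L AB KL_borel by (intro add_left_mono add_mono) (auto simp: marg1 marg2)
      finally have inner: "\<beta> (A \<times> B) \<le> \<beta> (K \<times> L) + ennreal (e / 2)"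
        using e by (simp flip: ennreal_plus)
      have "\<exists>W. open W \<and> R i \<subseteq> W \<and> \<beta> W \<le> \<beta> (R i) + ennreal (2 * d i)" for i
      proof -
        have "R i \<in> rectangles0"
          using R by auto
        then obtain A B where AB: "R i = A \<times> B" "A \<in> sets borel" "B \<in> sets borel"
          "0 \<notin> frontier A" "0 \<notin> frontier B"
          unfolding rectangles0_def by blast
        obtain U where U: "open U" "A \<subseteq> U" "0 \<notin> closure (U - A)" "emeasure \<mu> (U - A) \<le> ennreal (d i)"
          by (rule M0_outer_regular[OF M0(1) AB(2,4) d[of i]])
        obtain V where V: "open V" "B \<subseteq> V" "0 \<notin> closure (V - B)" "emeasure \<nu> (V - B) \<le> ennreal (d i)"
          by (rule M0_outer_regular[OF M0(2) AB(3,5) d[of i]])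
        have UV_borel: "U \<in> sets borel" "V \<in> sets borel"
          using U V by auto
        have "\<beta> (U \<times> V) \<le> \<beta> (A \<times> B) + (\<beta> ((U - A) \<times> UNIV) + \<beta> (UNIV \<times> (V - B)))"
          using AB UV_borel by (intro sub3) (auto intro!: borel_Times)
        also have "\<dots> \<le> \<beta> (A \<times> B) + (ennreal (d i) + ennreal (d i))"
          using U V AB UV_borel by (intro add_left_mono add_mono) (auto simp: marg1 marg2)
        finally have "\<beta> (U \<times> V) \<le> \<beta> (R i) + ennreal (2 * d i)"
          using d[of i] AB by (simp flip: ennreal_plus)
        with U V AB show ?thesis
          by (intro exI[of _ "U \<times> V"]) (auto intro: open_Times)
      qed
      then obtain W where W: "\<And>i. open (W i)" "\<And>i. R i \<subseteq> W i" "\<And>i. \<beta> (W i) \<le> \<beta> (R i) + ennreal (2 * d i)"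
        by metis
      have W_borel: "W i \<in> sets borel" for i
        using W(1) by simp
      have "compact (K \<times> L)"
        using K L by (intro compact_Times)
      moreover have "K \<times> L \<subseteq> (\<Union>i\<in>UNIV. W i)"
      proof -
        have "K \<times> L \<subseteq> A \<times> B"
          using K L by blast
        also have "\<dots> \<subseteq> (\<Union>i. W i)"
          unfolding AB(1)[symmetric] using W(2) by blast
        finally show ?thesis .
      qed
      ultimately obtain I where I: "finite I" "K \<times> L \<subseteq> (\<Union>i\<in>I. W i)"
        using W(1) by (elim compactE_image[of _ UNIV W]) auto
      have "\<beta> (K \<times> L) \<le> \<beta> (\<Union>i\<in>I. W i)"
        using I KL_borel W_borel by (intro mono borel_Times) auto
      also have "\<dots> \<le> (\<Sum>i\<in>I. \<beta> (W i))"
        using I W_borel by (intro sub)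
      also have "\<dots> \<le> (\<Sum>i\<in>I. \<beta> (R i) + ennreal (2 * d i))"
        using W(3) by (intro sum_mono)
      also have "\<dots> \<le> (\<Sum>i. \<beta> (R i) + ennreal (2 * d i))"
        using I by (intro sum_le_suminf) auto
      also have "\<dots> = (\<Sum>i. \<beta> (R i)) + (\<Sum>i. ennreal (2 * d i))"
        by (intro suminf_add[symmetric]) auto
      also have "(\<Sum>i. ennreal (2 * d i)) = ennreal (e / 2)"
      proof (rule suminf_ennreal_eq)
        show "(\<lambda>i. 2 * d i) sums (e / 2)"
          using sums_mult[OF power_half_series, of "e / 2"] by (simp add: d_def)
      qed (use d in \<open>simp add: less_imp_le\<close>)
      finally have "\<beta> (A \<times> B) \<le> (\<Sum>i. \<beta> (R i)) + ennreal (e / 2) + ennreal (e / 2)"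
        using inner by (meson add_right_mono order_trans)
      then show "\<beta> (\<Union>i. R i) \<le> (\<Sum>i. \<beta> (R i)) + ennreal e"
        using e by (simp add: AB(1) add.assoc flip: ennreal_plus)
    qed
    ultimately show "(\<Sum>i. \<beta> (R i)) = \<beta> (\<Union>i. R i)"
      by (rule antisym)
  qed
  have "positive rectangles0 \<beta>"
    using pos by (simp add: positive_def)
  then obtain \<gamma>' where \<gamma>': "\<And>R. R \<in> rectangles0 \<Longrightarrow> \<gamma>' R = \<beta> R"
    and ms: "measure_space (- {0}) (sigma_sets (- {0}) rectangles0) \<gamma>'"
    using semiring_of_sets.caratheodory[OF semiring_rectangles0 _ ca] by blast
  define \<gamma> where "\<gamma> = measure_of (- {0}) rectangles0 \<gamma>'"
  have Pow: "(rectangles0 :: ('a \<times> 'a) set set) \<subseteq> Pow (- {0})"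
    using zero_notin_rectangles0 by blast
  have sets: "sets \<gamma> = sigma_sets (- {0}) rectangles0"
    unfolding \<gamma>_def using Pow by (rule sets_measure_of)
  show ?thesis
  proof (rule that)
    show "sets \<gamma> = sets punctured_borel"
      unfolding sets by (rule sigma_sets_rectangles0)
    show "\<forall>R\<in>rectangles0. emeasure \<gamma> R = \<beta> R"
    proof
      fix R :: "('a \<times> 'a) set" assume R: "R \<in> rectangles0"
      have "emeasure \<gamma> R = \<gamma>' R"
        using ms Pow R sets
        by (intro emeasure_measure_of[OF \<gamma>_def]) (auto simp: measure_space_def sets intro: sigma_sets.Basic)
      with \<gamma>'[OF R] show "emeasure \<gamma> R = \<beta> R"
        by simp
    qed
  qed
qed

section \<open>Convergence along a filter, and properties of the limit\<close>

text \<open>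
  Uncountably many sets \<open>C\<close> rule out a diagonal subsequence, but the functions \<open>g n\<close> live in the
  space \<open>'b \<Rightarrow> ennreal\<close>, which is compact by Tychonoff's theorem. A cluster point \<open>\<beta>\<close>
  yields a filter \<open>G\<close> finer than \<open>sequentially\<close> along which \<open>g\<close> converges to \<open>\<beta>\<close>; limit laws for
  single sets hold along \<open>G\<close> as they do for sequences.
\<close>

lemma setwise_cluster_point:
  fixes g :: "nat \<Rightarrow> 'b \<Rightarrow> ennreal"
  obtains \<beta> G where "G \<noteq> bot" "G \<le> sequentially" "\<And>C. ((\<lambda>n. g n C) \<longlongrightarrow> \<beta> C) G"
proof -
  have "compact (UNIV :: ('b \<Rightarrow> ennreal) set)"
    using compact_PiE_UNIV[of "\<lambda>_::'b. UNIV :: ennreal set"] compact_UNIV by simp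
  then obtain \<beta> where \<beta>: "inf (nhds \<beta>) (filtermap g sequentially) \<noteq> bot"
    unfolding compact_filter
    by (elim allE[of _ "filtermap g sequentially"]) (auto simp: filtermap_bot_iff)
  define G where "G = inf (filtercomap g (nhds \<beta>)) sequentially"
  have "G \<noteq> bot"
  proof
    assume "G = bot"
    then have "eventually (\<lambda>_. False) (inf (filtercomap g (nhds \<beta>)) sequentially)"
      by (simp add: G_def)
    then obtain Q R where Q: "eventually Q (nhds \<beta>)" and R: "eventually R sequentially"
      and QR: "\<And>n. Q (g n) \<Longrightarrow> R n \<Longrightarrow> False"
      unfolding eventually_inf eventually_filtercomap by blast
    have "eventually (\<lambda>z. \<not> Q z) (filtermap g sequentially)"
      unfolding eventually_filtermap using R by eventually_elim (use QR in blast)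
    with Q have "eventually (\<lambda>_. False) (inf (nhds \<beta>) (filtermap g sequentially))"
      unfolding eventually_inf by blast
    with \<beta> show False
      by (simp add: trivial_limit_def)
  qed
  moreover have "G \<le> sequentially"
    by (simp add: G_def)
  moreover have "((\<lambda>n. g n C) \<longlongrightarrow> \<beta> C) G" for C
  proof -
    have lim: "filterlim g (nhds \<beta>) G"
      unfolding G_def by (rule filterlim_mono[OF filterlim_filtercomap order_refl inf_le1])
    have "continuous_on UNIV (\<lambda>f :: 'b \<Rightarrow> ennreal. f C)"
      by (rule continuous_on_product_coordinates)
    from continuous_on_tendsto_compose[OF this lim] show ?thesis
      by simp
  qed
  ultimately show ?thesis
    by (rule that)
qed

text \<open>
  Cover the ball of radius \<open>R\<close> by finitely many balls of radius \<open>\<delta>\<close> and send each point to the centre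
  of one that contains it.
\<close>

lemma finite_range_approximation:
  fixes R \<delta> :: real
  assumes "\<delta> > 0"
  obtains f :: "'a::euclidean_space \<Rightarrow> 'a" where
    "f \<in> borel_measurable borel" "finite (range f)" "\<And>x. norm x \<le> R \<Longrightarrow> dist (f x) x < \<delta>"
proof -
  have "compact (cball (0::'a) R)"
    by simp
  then obtain K :: "'a set" where K: "finite K" "cball 0 R \<subseteq> (\<Union>k\<in>K. ball k \<delta>)"
    using assms by (elim compactE_image[of _ UNIV "\<lambda>k. ball k \<delta>"]) (auto intro: centre_in_ball[THEN iffD2])
  have "\<exists>f\<in>borel_measurable borel. finite (range f) \<and> (\<forall>x\<in>(\<Union>k\<in>K. ball k \<delta>). dist (f x) x < \<delta>)"
    using K(1)
  proof induction
    case empty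
    show ?case
      by (intro bexI[of _ "\<lambda>_. 0"]) auto
  next
    case (insert k K)
    then obtain f where f: "f \<in> borel_measurable borel" "finite (range f)"
      "\<And>x. x \<in> (\<Union>k\<in>K. ball k \<delta>) \<Longrightarrow> dist (f x) x < \<delta>"
      by blast
    define f' where "f' x = (if x \<in> ball k \<delta> then k else f x)" for x
    have [measurable]: "f \<in> borel_measurable borel" "ball k \<delta> \<in> sets borel"
      using f(1) by auto
    have "f' \<in> borel_measurable borel"
      unfolding f'_def by measurable
    moreover have "range f' \<subseteq> insert k (range f)"
      by (auto simp: f'_def)
    then have "finite (range f')"
      using f(2) by (meson finite_insert finite_subset)
    moreover have "dist (f' x) x < \<delta>" if "x \<in> (\<Union>k\<in>insert k K. ball k \<delta>)" for x
      using f(3)[of x] that by (auto simp: f'_def)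
    ultimately show ?case
      by blast
  qed
  then obtain f where "f \<in> borel_measurable borel" "finite (range f)"
    "\<And>x. x \<in> (\<Union>k\<in>K. ball k \<delta>) \<Longrightarrow> dist (f x) x < \<delta>"
    by blast
  moreover have "x \<in> (\<Union>k\<in>K. ball k \<delta>)" if "norm x \<le> R" for x
    using K(2) that by (auto simp: subset_eq)
  ultimately show ?thesis
    by (intro that) auto
qed

text \<open>
  Exhaust \<open>A\<close> by its parts outside the balls of radius \<open>1 / (n + 1)\<close>. The map \<open>\<pi>\<close> stands for
  \<open>A \<mapsto> A \<times> UNIV\<close> and for \<open>A \<mapsto> UNIV \<times> A\<close>, so that both marginals are covered.
\<close>

lemma marginal_from_sets_away_from_zero:
  fixes \<rho> :: "'a::real_normed_vector measure"
  assumes \<rho>: "\<rho> \<in> M0" and A: "A \<in> sets punctured_borel" and \<pi>: "\<And>B C. B \<subseteq> C \<Longrightarrow> \<pi> B \<subseteq> \<pi> C"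
    "\<And>B :: nat \<Rightarrow> 'a set. \<pi> (\<Union>i. B i) = (\<Union>i. \<pi> (B i))"
    and eq: "\<And>B. B \<in> sets borel \<Longrightarrow> 0 \<notin> closure B \<Longrightarrow> \<pi> B \<in> sets \<gamma> \<and> emeasure \<gamma> (\<pi> B) = emeasure \<rho> B"
  shows "emeasure \<gamma> (\<pi> A) = emeasure \<rho> A"
proof -
  define B where "B n = A - ball 0 (inverse (real (Suc n)))" for n
  have A': "A \<in> sets borel" "0 \<notin> A"
    using A unfolding sets_punctured_borel by auto
  have B: "B n \<in> sets borel" "0 \<notin> closure (B n)" for n
    using A' zero_notin_closure_diff_ball[of "inverse (real (Suc n))" A] by (auto simp: B_def)
  have B_nonzero: "0 \<notin> B n" for n
    using A' by (simp add: B_def)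
  have inc: "incseq B"
    unfolding B_def by (intro incseq_SucI Diff_mono subset_ball) (auto simp: field_simps)
  have un: "(\<Union>n. B n) = A"
  proof
    show "A \<subseteq> (\<Union>n. B n)"
    proof
      fix x assume x: "x \<in> A"
      with A' have "norm x > 0"
        by auto
      then obtain n where "inverse (real (Suc n)) < norm x"
        using reals_Archimedean by blast
      with x show "x \<in> (\<Union>n. B n)"
        by (auto simp: B_def intro!: exI[of _ n])
    qed
  qed (auto simp: B_def)
  have "emeasure \<gamma> (\<pi> A) = emeasure \<gamma> (\<Union>n. \<pi> (B n))"
    using un \<pi>(2)[of B] by simp
  also have "\<dots> = (SUP n. emeasure \<gamma> (\<pi> (B n)))"
    using eq[OF B] inc \<pi>(1) by (intro SUP_emeasure_incseq[symmetric]) (auto simp: incseq_def)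
  also have "\<dots> = (SUP n. emeasure \<rho> (B n))"
    using eq[OF B] by simp
  also have "\<dots> = emeasure \<rho> A"
    unfolding un[symmetric] using inc B(1) B_nonzero
    by (intro SUP_emeasure_incseq) (auto simp: sets_M0[OF \<rho>])
  finally show ?thesis .
qed

lemma zero_coupling_if_marginals_away_from_zero:
  fixes \<mu> \<nu> :: "'a::euclidean_space measure"
  assumes M0: "\<mu> \<in> M0" "\<nu> \<in> M0" and sets: "sets \<gamma> = sets punctured_borel"
    and marg1: "\<And>A. A \<in> sets borel \<Longrightarrow> 0 \<notin> closure A \<Longrightarrow> emeasure \<gamma> (A \<times> UNIV) = emeasure \<mu> A"
    and marg2: "\<And>A. A \<in> sets borel \<Longrightarrow> 0 \<notin> closure A \<Longrightarrow> emeasure \<gamma> (UNIV \<times> A) = emeasure \<nu> A"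
  shows "\<gamma> \<in> zero_couplings \<mu> \<nu>"
proof -
  have *: "A \<times> UNIV \<in> sets \<gamma> \<and> UNIV \<times> A \<in> sets \<gamma>" if "A \<in> sets borel" "0 \<notin> closure A" for A
  proof -
    have "0 \<notin> A"
      using that closure_subset[of A] by blast
    then show ?thesis
      using that unfolding sets sets_punctured_borel by (simp add: borel_Times zero_prod_def)
  qed
  have "emeasure \<gamma> (A \<times> UNIV) = emeasure \<mu> A" if "A \<in> sets punctured_borel" for A
    by (rule marginal_from_sets_away_from_zero[OF M0(1) that]) (auto simp: * marg1)
  moreover have "emeasure \<gamma> (UNIV \<times> A) = emeasure \<nu> A" if "A \<in> sets punctured_borel" for A
    by (rule marginal_from_sets_away_from_zero[OF M0(2) that]) (auto simp: * marg2)
  ultimately show ?thesis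
    unfolding zero_couplings_def using sets by blast
qed

text \<open>
  Off the origin, \<open>W\<close> is a countable union of open rectangles of the semiring, and these cannot all be null.
  This holds for \<open>p = 0\<close> too, where the rectangle found does not contain \<open>p\<close>.
\<close>

lemma rectangle0_in_spt_neighbourhood:
  fixes \<gamma> :: "('a::{real_normed_vector, second_countable_topology} \<times> 'a) measure"
  assumes sets: "sets \<gamma> = sets punctured_borel" and p: "p \<in> spt \<gamma>" and W: "open W" "p \<in> W"
  obtains R where "R \<in> rectangles0" "open R" "R \<subseteq> W" "0 < emeasure \<gamma> R"
proof -
  obtain \<C> where \<C>: "countable \<C>" "\<C> \<subseteq> rectangles0" "\<Union>\<C> = W - {0}" "\<And>R. R \<in> \<C> \<Longrightarrow> open R"
    using open_Union_rectangles0[OF W(1)] by blast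
  have pos: "0 < emeasure \<gamma> (W - {0})"
    using p W unfolding spt_def by blast
  have "\<exists>R\<in>\<C>. 0 < emeasure \<gamma> R"
  proof (rule ccontr)
    assume "\<not> ?thesis"
    then have "R \<in> null_sets \<gamma>" if "R \<in> \<C>" for R
      using that \<C>(2) rectangles0_borel zero_notin_rectangles0
      by (intro null_setsI) (auto simp: sets sets_punctured_borel zero_less_iff_neq_zero)
    then have "(\<Union>R\<in>\<C>. R) \<in> null_sets \<gamma>"
      by (intro null_sets_UN'[OF \<C>(1)])
    with pos \<C>(3) show False
      by (simp add: null_setsD1)
  qed
  with \<C> show ?thesis
    using that by blast
qed

section \<open>Existence of a cyclically monotone zero-coupling\<close>

lemma dist_Pair_le: "dist (a, b) (c, d) \<le> dist a c + dist b d"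
  by (simp add: dist_prod_def sqrt_sum_squares_le_sum)

theorem theorem2p8:
  fixes \<mu> \<nu> :: "(real ^ 'd) measure"
  assumes "\<mu> \<in> M0" and "\<nu> \<in> M0"
  shows "zero_couplings_cm \<mu> \<nu> \<noteq> {}"
proof -
  define r where "r n = inverse (real (Suc n))" for n
  have r: "0 < r n" for n
    by (simp add: r_def)
  have small_r: "\<forall>\<^sub>F n in sequentially. r n < \<delta>" if "0 < \<delta>" for \<delta>
    using LIMSEQ_inverse_real_of_nat that unfolding r_def by (rule order_tendstoD(2))
  \<comment> \<open>The atom of each truncation carries the mass of the other measure outside the ball, so
      both have the same total mass.\<close>
  define P where "P n = truncated_measure \<mu> (r n) (emeasure \<nu> (- ball 0 (r n)))" for n
  define Q where "Q n = truncated_measure \<nu> (r n) (emeasure \<mu> (- ball 0 (r n)))" for n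
  have fin: "emeasure \<rho> (- ball 0 (r n)) < \<infinity>" if "\<rho> \<in> M0" for n and \<rho> :: "(real ^ 'd) measure"
    using that r[of n] by (intro emeasure_M0_finite) (auto simp: closure_complement)
  have P: "emeasure (P n) A = emeasure \<mu> (A - ball 0 (r n)) + emeasure \<nu> (- ball 0 (r n)) * indicator A 0"
    and Q: "emeasure (Q n) A = emeasure \<nu> (A - ball 0 (r n)) + emeasure \<mu> (- ball 0 (r n)) * indicator A 0"
    if "A \<in> sets borel" for n A
    unfolding P_def Q_def
    using assms r that by (simp_all only: emeasure_truncated_measure)
  define approx where "approx n f \<longleftrightarrow> f \<in> borel_measurable borel \<and> finite (range f) \<and>
      (\<forall>x. norm x \<le> real n \<longrightarrow> dist (f x) x < r n)" for n and f :: "real ^ 'd \<Rightarrow> real ^ 'd"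
  have "\<exists>f. approx n f" for n
    unfolding approx_def by (rule finite_range_approximation[OF r[of n]]) blast
  then obtain f where "\<And>n. approx n (f n)"
    by metis
  then have f: "f n \<in> borel_measurable borel" "finite (range (f n))"
    "norm x \<le> real n \<Longrightarrow> dist (f n x) x < r n" for n x
    unfolding approx_def by blast+
  define coupled where "coupled n \<gamma> S \<longleftrightarrow> sets \<gamma> = sets borel \<and>
      (\<forall>A\<in>sets borel. emeasure \<gamma> (A \<times> UNIV) = emeasure (P n) A) \<and>
      (\<forall>A\<in>sets borel. emeasure \<gamma> (UNIV \<times> A) = emeasure (Q n) A) \<and> cyclically_monotone S \<and>
      (\<forall>C\<in>sets borel. emeasure \<gamma> C > 0 \<longrightarrow> (\<exists>(x, y)\<in>C. (f n x, f n y) \<in> S))" for n \<gamma> S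
  have "\<exists>\<gamma> S. coupled n \<gamma> S" for n
  proof -
    have "finite_measure (P n)" "finite_measure (Q n)"
      unfolding P_def Q_def using assms r fin by (auto intro: finite_measure_truncated_measure)
    moreover have "sets (P n) = sets borel" "sets (Q n) = sets borel"
      by (simp_all add: P_def Q_def)
    moreover have "emeasure (P n) UNIV = emeasure (Q n) UNIV"
      by (simp add: P Q Compl_eq_Diff_UNIV add.commute)
    ultimately show ?thesis
      unfolding coupled_def
      by (rule coupling_near_cyclically_monotone[OF _ _ _ _ _ f(1)[of n] f(2)[of n]]) blast
  qed
  then obtain \<gamma> S where "\<And>n. coupled n (\<gamma> n) (S n)"
    by metis
  then have sets\<gamma>: "sets (\<gamma> n) = sets borel"
    and \<gamma>P: "A \<in> sets borel \<Longrightarrow> emeasure (\<gamma> n) (A \<times> UNIV) = emeasure (P n) A"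
    and \<gamma>Q: "A \<in> sets borel \<Longrightarrow> emeasure (\<gamma> n) (UNIV \<times> A) = emeasure (Q n) A"
    and S: "cyclically_monotone (S n)"
    and \<gamma>S: "C \<in> sets borel \<Longrightarrow> emeasure (\<gamma> n) C > 0 \<Longrightarrow> \<exists>(x, y)\<in>C. (f n x, f n y) \<in> S n" for n A C
    unfolding coupled_def by blast+
  obtain \<beta> G where G: "G \<noteq> bot" "G \<le> sequentially" and \<beta>: "\<And>C. ((\<lambda>n. emeasure (\<gamma> n) C) \<longlongrightarrow> \<beta> C) G"
    using setwise_cluster_point[of "\<lambda>n. emeasure (\<gamma> n)"] by blast
  have pos: "positive (sets borel) \<beta>"
    using tendsto_unique[OF G(1) \<beta>[of "{}"], of 0] by (simp add: positive_def)
  have add: "additive (sets borel) \<beta>"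
    unfolding additive_def
  proof (intro ballI impI)
    fix A B :: "((real ^ 'd) \<times> (real ^ 'd)) set"
    assume AB: "A \<in> sets borel" "B \<in> sets borel" "A \<inter> B = {}"
    then have "emeasure (\<gamma> n) (A \<union> B) = emeasure (\<gamma> n) A + emeasure (\<gamma> n) B" for n
      by (intro plus_emeasure[symmetric]) (auto simp: sets\<gamma>)
    with tendsto_add[OF \<beta>[of A] \<beta>[of B]] have "((\<lambda>n. emeasure (\<gamma> n) (A \<union> B)) \<longlongrightarrow> \<beta> A + \<beta> B) G"
      by simp
    then show "\<beta> (A \<union> B) = \<beta> A + \<beta> B"
      by (rule tendsto_unique[OF G(1) \<beta>])
  qed
  have away: "\<forall>\<^sub>F n in G. A - ball 0 (r n) = A" "0 \<notin> A"
    if A0: "0 \<notin> closure A" for A :: "(real ^ 'd) set"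
  proof -
    obtain s where s: "s > 0" "\<forall>x\<in>A. \<not> dist x 0 < s"
      using A0 unfolding closure_approachable by blast
    have "\<forall>\<^sub>F n in sequentially. A - ball 0 (r n) = A"
      using small_r[OF s(1)]
    proof eventually_elim
      case (elim n)
      have "x \<notin> ball 0 (r n)" if "x \<in> A" for x
        using bspec[OF s(2) that] elim by simp
      then show ?case
        by blast
    qed
    then show "\<forall>\<^sub>F n in G. A - ball 0 (r n) = A"
      using G(2) by (rule filter_leD[rotated])
    show "0 \<notin> A"
      using A0 closure_subset[of A] by blast
  qed
  have marg1: "\<beta> (A \<times> UNIV) = emeasure \<mu> A" if "A \<in> sets borel" "0 \<notin> closure A" for A
  proof -
    have "\<forall>\<^sub>F n in G. emeasure (\<gamma> n) (A \<times> UNIV) = emeasure \<mu> A"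
      using away(1)[OF that(2)] by eventually_elim (use that away(2)[OF that(2)] in \<open>simp add: \<gamma>P P\<close>)
    then show ?thesis
      by (intro tendsto_unique[OF G(1) \<beta>] tendsto_eventually)
  qed
  have marg2: "\<beta> (UNIV \<times> A) = emeasure \<nu> A" if "A \<in> sets borel" "0 \<notin> closure A" for A
  proof -
    have "\<forall>\<^sub>F n in G. emeasure (\<gamma> n) (UNIV \<times> A) = emeasure \<nu> A"
      using away(1)[OF that(2)] by eventually_elim (use that away(2)[OF that(2)] in \<open>simp add: \<gamma>Q Q\<close>)
    then show ?thesis
      by (intro tendsto_unique[OF G(1) \<beta>] tendsto_eventually)
  qed
  obtain \<gamma>' where sets\<gamma>': "sets \<gamma>' = sets punctured_borel"
    and ext: "\<forall>R\<in>rectangles0. emeasure \<gamma>' R = \<beta> R"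
    by (rule measure_extending_content[OF assms pos add marg1 marg2])
  have \<gamma>': "emeasure \<gamma>' R = \<beta> R" if "R \<in> rectangles0" for R
    using ext that by blast
  have rect: "A \<times> UNIV \<in> rectangles0" "UNIV \<times> A \<in> rectangles0"
    if "A \<in> sets borel" "0 \<notin> closure A" for A :: "(real ^ 'd) set"
    using that away(2)[OF that(2)] by (auto intro!: rectangles0I simp: frontier_def)
  have "\<gamma>' \<in> zero_couplings \<mu> \<nu>"
    using sets\<gamma>' by (intro zero_coupling_if_marginals_away_from_zero assms) (simp_all add: \<gamma>' rect marg1 marg2)
  moreover have "cyclically_monotone (spt \<gamma>')"
  proof (rule cyclically_monotone_if_approximable)
    fix F :: "((real ^ 'd) \<times> (real ^ 'd)) set" and \<delta> :: real
    assume F: "finite F" "F \<subseteq> spt \<gamma>'" and \<delta>: "0 < \<delta>"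
    have "\<forall>\<^sub>F n in G. \<exists>q\<in>S n. dist p q < \<delta>" if p: "p \<in> F" for p
    proof -
      have "p \<in> spt \<gamma>'" "p \<in> ball p (\<delta> / 2)"
        using F p \<delta> by auto
      then obtain R where R: "R \<in> rectangles0" "R \<subseteq> ball p (\<delta> / 2)" "0 < emeasure \<gamma>' R"
        by (rule rectangle0_in_spt_neighbourhood[OF sets\<gamma>' _ open_ball])
      have R_borel: "R \<in> sets borel"
        using R(1) by (rule rectangles0_borel)
      have "\<forall>\<^sub>F n in G. 0 < emeasure (\<gamma> n) R"
        using \<beta>[of R] R(3) unfolding \<gamma>'[OF R(1)] by (rule order_tendstoD(1))
      moreover have "\<forall>\<^sub>F n in G. r n < \<delta> / 4"
        using filter_leD[OF G(2) small_r[of "\<delta> / 4"]] \<delta> by simp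
      \<comment> \<open>The rounding \<open>f n\<close> is accurate on the ball of radius \<open>n\<close>, which has to contain the
          coordinates of all points near \<open>p\<close>.\<close>
      moreover have "\<forall>\<^sub>F n in G. norm p + \<delta> \<le> real n"
        by (intro filter_leD[OF G(2)] eventually_sequentiallyI[of "nat \<lceil>norm p + \<delta>\<rceil>"]) linarith
      ultimately show ?thesis
      proof eventually_elim
        fix n assume n: "0 < emeasure (\<gamma> n) R" "r n < \<delta> / 4" "norm p + \<delta> \<le> real n"
        obtain x y where xy: "(x, y) \<in> R" "(f n x, f n y) \<in> S n"
          using \<gamma>S[OF R_borel n(1)] by blast
        have near: "dist p (x, y) < \<delta> / 2"
          using xy(1) R(2) by auto
        have "norm (x, y) \<le> norm p + dist p (x, y)"
          using norm_triangle_ineq2[of "(x, y)" p] by (simp add: dist_norm norm_minus_commute)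
        with near n(3) \<delta> have "norm (x, y) \<le> real n"
          by linarith
        then have "dist (f n x) x < r n" "dist (f n y) y < r n"
          using f(3) norm_fst_le[of x y] norm_snd_le[of y x] by force+
        with near n(2) dist_Pair_le[of "f n x" "f n y" x y] dist_triangle[of p "(f n x, f n y)" "(x, y)"]
        have "dist p (f n x, f n y) < \<delta>"
          by (simp add: dist_commute)
        with xy(2) show "\<exists>q\<in>S n. dist p q < \<delta>"
          by blast
      qed
    qed
    then have "\<forall>\<^sub>F n in G. \<forall>p\<in>F. \<exists>q\<in>S n. dist p q < \<delta>"
      using F(1) by (intro eventually_ball_finite) auto
    then obtain n where "\<forall>p\<in>F. \<exists>q\<in>S n. dist p q < \<delta>"
      using eventually_happens'[OF G(1)] by blast
    with S show "\<exists>S. cyclically_monotone S \<and> (\<forall>p\<in>F. \<exists>q\<in>S. dist p q < \<delta>)"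
      by blast
  qed
  ultimately show ?thesis
    unfolding zero_couplings_cm_def by blast
qed

end
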